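(* Let $X$ be a nonempty set. Then the full fuzzy set system $E=[0,1]^X$, regarded as an effect algebra with $f\oplus g=f+g$ defined exactly when $f+g\le 1$ pointwise (with zero the constant function $0$ and unit the constant function $1$), admits a unique sequential product.
   Context: An effect algebra is a system $(E,0,1,\oplus)$ where $0\neq 1\in E$ and $\oplus$ is a partial binary operation on $E$ such that: (A1) if $a\oplus b$ is defined then $b\oplus a$ is defined and $b\oplus a=a\oplus b$; (A2) if $a\oplus b$ and $(a\oplus b)\oplus c$ are defined, then $b\oplus c$ and $a\oplus(b\oplus c)$ are defined and $a\oplus(b\oplus c)=(a\oplus b)\oplus c$; (A3) for every $a\in E$ there is a unique $a'\in E$ with $a\oplus a'=1$; (A4) if $a\oplus 1$ is defined then $a=0$. We write $a\perp b$ if $a\oplus b$ is defined. For a binary operation $\circ$ on $E$ write $a\mid b$ if $a\circ b=b\circ a$. A sequential product on an effect algebra $E$ is a binary operation $\circ\colon E\times E\to E$ such that: (S1) if $b\perp c$ then $a\circ b\perp a\circ c$ and $a\circ(b\oplus c)=a\circ b\oplus a\circ c$; (S2) $1\circ a=a$ for all $a$; (S3) if $a\circ b=0$ then $a\mid b$; (S4) if $a\mid b$ then $a\mid b'$ and $a\circ(b\circ c)=(a\circ b)\circ c$ for all $c$; (S5) if $c\mid a$ and $c\mid b$ then $c\mid a\circ b$ and, when $a\perp b$, $c\mid(a\oplus b)$. *)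

theory Defs
  imports Complex_Main "HOL-Library.FuncSet"
begin

text \<open>
  The partial operation is encoded with \<^typ>\<open>'e option\<close>: \<open>a \<oplus> b = Some c\<close> means that
  \<open>a \<oplus> b\<close> is defined (\<open>a \<bottom> b\<close>) with value \<open>c\<close>. Its values at arguments outside the carrier \<open>E\<close>
  are irrelevant.
\<close>

locale effect_algebra =
  fixes E :: "'e set"
    and zero :: 'e (\<open>\<zero>\<close>)
    and one :: 'e (\<open>\<one>\<close>)
    and oplus :: "'e \<Rightarrow> 'e \<Rightarrow> 'e option" (infixl \<open>\<oplus>\<close> 65)
  assumes zero_closed: "\<zero> \<in> E"
    and one_closed: "\<one> \<in> E"
    and zero_neq_one: "\<zero> \<noteq> \<one>"
    and oplus_closed: "\<lbrakk>a \<in> E; b \<in> E; a \<oplus> b = Some c\<rbrakk> \<Longrightarrow> c \<in> E"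
    and A1: "\<lbrakk>a \<in> E; b \<in> E; a \<oplus> b = Some s\<rbrakk> \<Longrightarrow> b \<oplus> a = Some s"
    and A2: "\<lbrakk>a \<in> E; b \<in> E; c \<in> E; a \<oplus> b = Some d; d \<oplus> c = Some s\<rbrakk>
      \<Longrightarrow> \<exists>e. b \<oplus> c = Some e \<and> a \<oplus> e = Some s"
    and A3: "a \<in> E \<Longrightarrow> \<exists>!a'. a' \<in> E \<and> a \<oplus> a' = Some \<one>"
    and A4: "\<lbrakk>a \<in> E; a \<oplus> \<one> \<noteq> None\<rbrakk> \<Longrightarrow> a = \<zero>"
begin

definition compl :: "'e \<Rightarrow> 'e" where
  "compl a = (THE a'. a' \<in> E \<and> a \<oplus> a' = Some \<one>)"

end

definition commutes :: "('e \<Rightarrow> 'e \<Rightarrow> 'e) \<Rightarrow> 'e \<Rightarrow> 'e \<Rightarrow> bool" where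
  "commutes p a b \<longleftrightarrow> p a b = p b a"

locale sequential_product = effect_algebra +
  fixes seq :: "'a \<Rightarrow> 'a \<Rightarrow> 'a" (infixl \<open>\<odot>\<close> 70)
  assumes seq_closed: "\<lbrakk>a \<in> E; b \<in> E\<rbrakk> \<Longrightarrow> a \<odot> b \<in> E"
    and S1: "\<lbrakk>a \<in> E; b \<in> E; c \<in> E; b \<oplus> c = Some s\<rbrakk>
      \<Longrightarrow> (a \<odot> b) \<oplus> (a \<odot> c) = Some (a \<odot> s)"
    and S2: "a \<in> E \<Longrightarrow> \<one> \<odot> a = a"
    and S3: "\<lbrakk>a \<in> E; b \<in> E; a \<odot> b = \<zero>\<rbrakk> \<Longrightarrow> commutes (\<odot>) a b"
    and S4_compl: "\<lbrakk>a \<in> E; b \<in> E; commutes (\<odot>) a b\<rbrakk> \<Longrightarrow> commutes (\<odot>) a (compl b)"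
    and S4_assoc: "\<lbrakk>a \<in> E; b \<in> E; c \<in> E; commutes (\<odot>) a b\<rbrakk>
      \<Longrightarrow> a \<odot> (b \<odot> c) = (a \<odot> b) \<odot> c"
    and S5_seq: "\<lbrakk>a \<in> E; b \<in> E; c \<in> E; commutes (\<odot>) c a; commutes (\<odot>) c b\<rbrakk>
      \<Longrightarrow> commutes (\<odot>) c (a \<odot> b)"
    and S5_oplus: "\<lbrakk>a \<in> E; b \<in> E; c \<in> E; commutes (\<odot>) c a; commutes (\<odot>) c b; a \<oplus> b = Some s\<rbrakk>
      \<Longrightarrow> commutes (\<odot>) c s"

text \<open>
  Functions on \<open>X\<close> are represented by total functions that are \<^const>\<open>undefined\<close> outside \<open>X\<close>,
  so that equality of representatives is equality on \<open>X\<close>.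
\<close>

definition fuzzy_sets :: "'x set \<Rightarrow> ('x \<Rightarrow> real) set" where
  "fuzzy_sets X = X \<rightarrow>\<^sub>E {0..1}"

definition fuzzy_zero :: "'x set \<Rightarrow> 'x \<Rightarrow> real" where
  "fuzzy_zero X = (\<lambda>x\<in>X. 0)"

definition fuzzy_one :: "'x set \<Rightarrow> 'x \<Rightarrow> real" where
  "fuzzy_one X = (\<lambda>x\<in>X. 1)"

definition fuzzy_oplus :: "'x set \<Rightarrow> ('x \<Rightarrow> real) \<Rightarrow> ('x \<Rightarrow> real) \<Rightarrow> ('x \<Rightarrow> real) option" where
  "fuzzy_oplus X f g =
    (if \<forall>x\<in>X. f x + g x \<le> 1 then Some (\<lambda>x\<in>X. f x + g x) else None)"

end

theory Submission
  imports Defs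
begin

text \<open>
  For existence, pointwise multiplication works. For uniqueness, an indicator function \<open>e\<close> has only
  \<open>0\<close> below both \<open>e\<close> and \<open>e'\<close>, which forces \<open>e \<circ> e' = 0\<close>; by (S3) and (S4) it then commutes with
  everything below \<open>e\<close> or below \<open>e'\<close>, hence by (S5) with every \<open>a\<close>, and \<open>e \<circ> a\<close> is the pointwise
  product. So (S4) gives \<open>e \<circ> (a \<circ> b) = a \<circ> (e \<circ> b)\<close>. For \<open>e\<close> the indicator of a point \<open>x\<close> we have
  \<open>e \<circ> b = b(x) e\<close>, and since \<open>t \<mapsto> (a \<circ> t e)(x)\<close> is additive and bounded, it is linear, so that
  \<open>(a \<circ> b)(x) = b(x) (a \<circ> e)(x) = a(x) b(x)\<close>.
\<close>

section \<open>Fuzzy sets as an effect algebra\<close>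

lemma fuzzy_setsD:
  assumes "f \<in> fuzzy_sets X" "x \<in> X"
  shows "0 \<le> f x" "f x \<le> 1"
  using assms by (auto simp: fuzzy_sets_def PiE_iff)

lemma fuzzy_setsI:
  "(\<And>x. x \<in> X \<Longrightarrow> 0 \<le> f x \<and> f x \<le> 1) \<Longrightarrow> restrict f X \<in> fuzzy_sets X"
  by (auto simp: fuzzy_sets_def)

lemma fuzzy_sets_eqI:
  assumes "f \<in> fuzzy_sets X" "g \<in> fuzzy_sets X" "\<And>x. x \<in> X \<Longrightarrow> f x = g x"
  shows "f = g"
  using assms by (auto simp: fuzzy_sets_def intro: PiE_ext)

lemma fuzzy_oplus_eq_Some_iff:
  "fuzzy_oplus X f g = Some h \<longleftrightarrow> (\<forall>x\<in>X. f x + g x \<le> 1) \<and> h = (\<lambda>x\<in>X. f x + g x)"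
  by (auto simp: fuzzy_oplus_def)

lemma fuzzy_zero_closed: "fuzzy_zero X \<in> fuzzy_sets X"
  and fuzzy_one_closed: "fuzzy_one X \<in> fuzzy_sets X"
  by (auto simp: fuzzy_zero_def fuzzy_one_def intro: fuzzy_setsI)

definition fuzzy_compl :: "'x set \<Rightarrow> ('x \<Rightarrow> real) \<Rightarrow> 'x \<Rightarrow> real" where
  "fuzzy_compl X f = (\<lambda>x\<in>X. 1 - f x)"

lemma fuzzy_compl_closed: "f \<in> fuzzy_sets X \<Longrightarrow> fuzzy_compl X f \<in> fuzzy_sets X"
  unfolding fuzzy_compl_def by (rule fuzzy_setsI) (auto dest: fuzzy_setsD)

text \<open>Yields existence and uniqueness in (A3) at once, and later evaluates the definite
  description behind \<open>compl\<close>.\<close>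

lemma fuzzy_oplus_eq_one_iff:
  assumes "f \<in> fuzzy_sets X" "g \<in> fuzzy_sets X"
  shows "fuzzy_oplus X f g = Some (fuzzy_one X) \<longleftrightarrow> g = fuzzy_compl X f"
proof
  assume "fuzzy_oplus X f g = Some (fuzzy_one X)"
  then have eq: "fuzzy_one X = (\<lambda>x\<in>X. f x + g x)"
    by (simp add: fuzzy_oplus_eq_Some_iff)
  have "g x = fuzzy_compl X f x" if "x \<in> X" for x
    using fun_cong[OF eq, of x] that by (simp add: fuzzy_one_def fuzzy_compl_def)
  then show "g = fuzzy_compl X f"
    using assms by (blast intro: fuzzy_sets_eqI fuzzy_compl_closed)
qed (auto simp: fuzzy_oplus_eq_Some_iff fuzzy_compl_def fuzzy_one_def fun_eq_iff)

lemma effect_algebra_fuzzy_sets: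
  assumes "X \<noteq> {}"
  shows "effect_algebra (fuzzy_sets X) (fuzzy_zero X) (fuzzy_one X) (fuzzy_oplus X)"
proof
  show "fuzzy_zero X \<noteq> fuzzy_one X"
    using assms by (auto simp: fuzzy_zero_def fuzzy_one_def restrict_def fun_eq_iff)
next
  fix a b c
  assume "a \<in> fuzzy_sets X" "b \<in> fuzzy_sets X" "fuzzy_oplus X a b = Some c"
  then show "c \<in> fuzzy_sets X"
    by (auto simp: fuzzy_oplus_eq_Some_iff intro!: fuzzy_setsI add_nonneg_nonneg
        elim: fuzzy_setsD(1))
next
  fix a b s
  assume "fuzzy_oplus X a b = Some s"
  then show "fuzzy_oplus X b a = Some s"
    by (simp add: fuzzy_oplus_eq_Some_iff add.commute)
next
  fix a b c d s
  assume a: "a \<in> fuzzy_sets X" and "b \<in> fuzzy_sets X" "c \<in> fuzzy_sets X"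
    and "fuzzy_oplus X a b = Some d" "fuzzy_oplus X d c = Some s"
  then have abc: "\<forall>x\<in>X. a x + b x + c x \<le> 1" and s: "s = (\<lambda>x\<in>X. a x + b x + c x)"
    by (auto simp: fuzzy_oplus_eq_Some_iff)
  have "b x + c x \<le> 1" if "x \<in> X" for x
    using bspec[OF abc that] fuzzy_setsD(1)[OF a that] by linarith
  with abc s show "\<exists>e. fuzzy_oplus X b c = Some e \<and> fuzzy_oplus X a e = Some s"
    by (auto simp: fuzzy_oplus_eq_Some_iff add.assoc)
next
  fix a
  assume "a \<in> fuzzy_sets X"
  then show "\<exists>!a'. a' \<in> fuzzy_sets X \<and> fuzzy_oplus X a a' = Some (fuzzy_one X)"
    by (intro ex1I[of _ "fuzzy_compl X a"])
      (auto simp: fuzzy_oplus_eq_one_iff fuzzy_compl_closed)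
next
  fix a
  assume a: "a \<in> fuzzy_sets X" and "fuzzy_oplus X a (fuzzy_one X) \<noteq> None"
  then have le: "\<forall>x\<in>X. a x \<le> 0"
    by (auto simp: fuzzy_oplus_eq_Some_iff fuzzy_one_def)
  show "a = fuzzy_zero X"
  proof (rule fuzzy_sets_eqI[OF a fuzzy_zero_closed])
    fix x assume x: "x \<in> X"
    show "a x = fuzzy_zero X x"
      using bspec[OF le x] fuzzy_setsD(1)[OF a x] x by (simp add: fuzzy_zero_def)
  qed
qed (rule fuzzy_zero_closed fuzzy_one_closed)+

lemma compl_fuzzy_sets:
  assumes "effect_algebra (fuzzy_sets X) (fuzzy_zero X) (fuzzy_one X) (fuzzy_oplus X)"
    and "a \<in> fuzzy_sets X"
  shows "effect_algebra.compl (fuzzy_sets X) (fuzzy_one X) (fuzzy_oplus X) a = fuzzy_compl X a"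
  unfolding effect_algebra.compl_def[OF assms(1)]
  using assms(2)
  by (intro the_equality) (auto simp: fuzzy_oplus_eq_one_iff fuzzy_compl_closed)

section \<open>Existence: the pointwise product\<close>

text \<open>Restricted in both arguments, so that it lies in the extensional function space in which
  uniqueness is claimed.\<close>

definition fuzzy_times :: "'x set \<Rightarrow> ('x \<Rightarrow> real) \<Rightarrow> ('x \<Rightarrow> real) \<Rightarrow> 'x \<Rightarrow> real" where
  "fuzzy_times X = (\<lambda>f\<in>fuzzy_sets X. \<lambda>g\<in>fuzzy_sets X. \<lambda>x\<in>X. f x * g x)"

lemma fuzzy_times_apply:
  "f \<in> fuzzy_sets X \<Longrightarrow> g \<in> fuzzy_sets X \<Longrightarrow> fuzzy_times X f g = (\<lambda>x\<in>X. f x * g x)"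
  by (simp add: fuzzy_times_def)

lemma fuzzy_times_closed:
  "f \<in> fuzzy_sets X \<Longrightarrow> g \<in> fuzzy_sets X \<Longrightarrow> fuzzy_times X f g \<in> fuzzy_sets X"
  by (simp add: fuzzy_times_apply fuzzy_setsI fuzzy_setsD mult_le_one)

lemma fuzzy_times_commutes:
  "f \<in> fuzzy_sets X \<Longrightarrow> g \<in> fuzzy_sets X \<Longrightarrow> commutes (fuzzy_times X) f g"
  by (simp add: commutes_def fuzzy_times_apply mult.commute)

lemma sequential_product_fuzzy_times:
  assumes "X \<noteq> {}"
  shows "sequential_product (fuzzy_sets X) (fuzzy_zero X) (fuzzy_one X) (fuzzy_oplus X)
    (fuzzy_times X)"
proof -
  interpret effect_algebra "fuzzy_sets X" "fuzzy_zero X" "fuzzy_one X" "fuzzy_oplus X"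
    using assms by (rule effect_algebra_fuzzy_sets)
  show ?thesis
  proof
    fix a b c s
    assume a: "a \<in> fuzzy_sets X" and b: "b \<in> fuzzy_sets X" and c: "c \<in> fuzzy_sets X"
      and bc: "fuzzy_oplus X b c = Some s"
    have s: "s \<in> fuzzy_sets X" and s_eq: "s = (\<lambda>x\<in>X. b x + c x)"
      using oplus_closed[OF b c bc] bc by (auto simp: fuzzy_oplus_eq_Some_iff)
    \<comment> \<open>The sum is the value at \<open>x\<close> of the product of \<open>a\<close>
      and \<open>s\<close>, and this product is again a fuzzy set.\<close>
    have "a x * b x + a x * c x \<le> 1" if "x \<in> X" for x
      using fuzzy_setsD(2)[OF fuzzy_times_closed[OF a s] that] that
      unfolding fuzzy_times_apply[OF a s] by (simp add: s_eq distrib_left)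
    then show "fuzzy_oplus X (fuzzy_times X a b) (fuzzy_times X a c) = Some (fuzzy_times X a s)"
      using s_eq
      by (auto simp: fuzzy_times_apply a b c s fuzzy_oplus_eq_Some_iff distrib_left fun_eq_iff)
  next
    fix a
    assume a: "a \<in> fuzzy_sets X"
    show "fuzzy_times X (fuzzy_one X) a = a"
      by (rule fuzzy_sets_eqI[OF fuzzy_times_closed[OF fuzzy_one_closed a] a])
        (simp add: fuzzy_times_apply a fuzzy_one_closed, simp add: fuzzy_one_def)
  next
    fix a b c
    assume a: "a \<in> fuzzy_sets X" and b: "b \<in> fuzzy_sets X" and c: "c \<in> fuzzy_sets X"
    show "fuzzy_times X a (fuzzy_times X b c) = fuzzy_times X (fuzzy_times X a b) c"
      unfolding fuzzy_times_apply[OF a fuzzy_times_closed[OF b c]]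
        fuzzy_times_apply[OF fuzzy_times_closed[OF a b] c]
      by (simp add: fuzzy_times_apply a b c mult.assoc fun_eq_iff)
  next
    fix a b c s
    assume "a \<in> fuzzy_sets X" "b \<in> fuzzy_sets X" "c \<in> fuzzy_sets X" "fuzzy_oplus X a b = Some s"
    then show "commutes (fuzzy_times X) c s"
      by (blast intro: fuzzy_times_commutes oplus_closed)
  qed (simp_all add: fuzzy_times_commutes fuzzy_times_closed fuzzy_compl_closed
      compl_fuzzy_sets[OF effect_algebra_axioms])
qed

section \<open>Bounded additive functions on the unit interval\<close>

text \<open>
  Doubling the argument modulo \<open>1\<close> doubles the deviation from linearity, so a bound \<open>1\<close> on the
  deviation improves to \<open>2\<^sup>-\<^sup>n\<close> for every \<open>n\<close>.
\<close>

lemma additive_unit_interval_linear: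
  fixes \<phi> :: "real \<Rightarrow> real"
  assumes add: "\<And>s t. \<lbrakk>0 \<le> s; 0 \<le> t; s + t \<le> 1\<rbrakk> \<Longrightarrow> \<phi> (s + t) = \<phi> s + \<phi> t"
    and bnd: "\<And>t. \<lbrakk>0 \<le> t; t \<le> 1\<rbrakk> \<Longrightarrow> 0 \<le> \<phi> t \<and> \<phi> t \<le> 1"
    and t: "0 \<le> t" "t \<le> 1"
  shows "\<phi> t = t * \<phi> 1"
proof -
  define d where "d t = \<phi> t - t * \<phi> 1" for t
  have d_add: "d (s + t) = d s + d t" if "0 \<le> s" "0 \<le> t" "s + t \<le> 1" for s t
    using add[OF that] by (simp add: d_def algebra_simps)
  \<comment> \<open>By construction \<open>d 1 = 0\<close>, and additivity makes this
    \<open>2 * d (1/2)\<close>.\<close>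
  have d_half: "d (1/2) = 0"
    using d_add[of "1/2" "1/2"] by (simp add: d_def)
  have dev: "\<bar>d t\<bar> \<le> 1 / 2 ^ n" if "0 \<le> t" "t \<le> 1" for n t
    using that
  proof (induction n arbitrary: t)
    case 0
    \<comment> \<open>Both \<open>\<phi> t\<close> and \<open>t * \<phi> 1\<close> lie in the unit
      interval, so they differ by at most 1.\<close>
    have "0 \<le> t * \<phi> 1" "t * \<phi> 1 \<le> 1"
      using bnd[of 1] 0 by (auto intro: mult_le_one)
    then show ?case
      using bnd[OF 0] by (auto simp: d_def)
  next
    case (Suc n)
    have "\<exists>u. 0 \<le> u \<and> u \<le> 1 \<and> d u = 2 * d t"
    proof (cases "t \<le> 1/2")
      case True
      then show ?thesis
        using Suc.prems d_add[of t t] by (intro exI[of _ "t + t"]) auto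
    next
      case False
      \<comment> \<open>Since \<open>d (1/2) = 0\<close>, the deviations at \<open>t\<close> and
        \<open>t - 1/2\<close> agree, and \<open>t - 1/2\<close> can be doubled without leaving the
        interval.\<close>
      then show ?thesis
        using Suc.prems d_add[of "1/2" "t - 1/2"] d_add[of "t - 1/2" "t - 1/2"] d_half
        by (intro exI[of _ "(t - 1/2) + (t - 1/2)"]) auto
    qed
    then show ?case
      using Suc.IH by (fastforce simp: field_simps abs_mult)
  qed
  have "(\<lambda>n. 1 / 2 ^ n :: real) \<longlonglongrightarrow> 0"
    by (rule LIMSEQ_divide_realpow_zero) simp
  then have "\<bar>d t\<bar> \<le> 0"
    using dev[OF t] by (intro LIMSEQ_le_const) auto
  then show ?thesis
    by (simp add: d_def)
qed

section \<open>Restrictions and indicators\<close>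

text \<open>The argument \<open>f\<close> may be any total function, so constants are allowed: this
  one construction covers parts of fuzzy sets, indicators and scaled indicators.\<close>

definition fuzzy_restrict :: "'x set \<Rightarrow> 'x set \<Rightarrow> ('x \<Rightarrow> real) \<Rightarrow> 'x \<Rightarrow> real" where
  "fuzzy_restrict X S f = (\<lambda>x\<in>X. if x \<in> S then f x else 0)"

abbreviation fuzzy_ind :: "'x set \<Rightarrow> 'x set \<Rightarrow> 'x \<Rightarrow> real" where
  "fuzzy_ind X S \<equiv> fuzzy_restrict X S (\<lambda>_. 1)"

lemma fuzzy_restrict_closed:
  "f \<in> fuzzy_sets X \<Longrightarrow> fuzzy_restrict X S f \<in> fuzzy_sets X"
  unfolding fuzzy_restrict_def by (rule fuzzy_setsI) (auto dest: fuzzy_setsD)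

lemma fuzzy_ind_scaled_closed:
  "0 \<le> t \<Longrightarrow> t \<le> 1 \<Longrightarrow> fuzzy_restrict X S (\<lambda>_. t) \<in> fuzzy_sets X"
  unfolding fuzzy_restrict_def by (rule fuzzy_setsI) auto

lemma fuzzy_compl_ind: "fuzzy_compl X (fuzzy_ind X S) = fuzzy_ind X (- S)"
  by (auto simp: fuzzy_compl_def fuzzy_restrict_def fun_eq_iff)

section \<open>Additivity, order and units for an arbitrary sequential product\<close>

locale fuzzy_sequential_product =
  sequential_product "fuzzy_sets X" "fuzzy_zero X" "fuzzy_one X" "fuzzy_oplus X" seq
  for X :: "'x set" and seq :: "('x \<Rightarrow> real) \<Rightarrow> ('x \<Rightarrow> real) \<Rightarrow> 'x \<Rightarrow> real" (infixl \<open>\<odot>\<close> 70)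
begin

lemmas compl_eq = compl_fuzzy_sets[OF effect_algebra_axioms]

lemma commutes_sym: "commutes (\<odot>) a b \<Longrightarrow> commutes (\<odot>) b a"
  by (simp add: commutes_def)

text \<open>Pointwise form of (S1): as the sum \<open>s\<close> is itself a fuzzy set,
  \<open>b\<close> and \<open>c\<close> are automatically summable.\<close>

lemma seq_add:
  assumes a: "a \<in> fuzzy_sets X" and b: "b \<in> fuzzy_sets X" and c: "c \<in> fuzzy_sets X"
    and s: "s \<in> fuzzy_sets X" and eq: "\<And>x. x \<in> X \<Longrightarrow> s x = b x + c x" and x: "x \<in> X"
  shows "(a \<odot> s) x = (a \<odot> b) x + (a \<odot> c) x"
proof -
  have "b x + c x \<le> 1" if "x \<in> X" for x
    using fuzzy_setsD(2)[OF s that] eq[OF that] by simp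
  moreover have "s = (\<lambda>x\<in>X. b x + c x)"
    using s eq by (auto simp: fuzzy_sets_def PiE_iff extensional_def fun_eq_iff)
  ultimately have "fuzzy_oplus X b c = Some s"
    by (simp add: fuzzy_oplus_eq_Some_iff)
  from S1[OF a b c this] have "a \<odot> s = (\<lambda>x\<in>X. (a \<odot> b) x + (a \<odot> c) x)"
    by (simp add: fuzzy_oplus_eq_Some_iff)
  then show ?thesis
    using x by simp
qed

text \<open>The difference \<open>c - b\<close> is a fuzzy set, and its product with
  \<open>a\<close> is nonnegative.\<close>

lemma seq_mono:
  assumes a: "a \<in> fuzzy_sets X" and b: "b \<in> fuzzy_sets X" and c: "c \<in> fuzzy_sets X"
    and le: "\<And>x. x \<in> X \<Longrightarrow> b x \<le> c x" and x: "x \<in> X"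
  shows "(a \<odot> b) x \<le> (a \<odot> c) x"
proof -
  define d where "d = (\<lambda>x\<in>X. c x - b x)"
  have d: "d \<in> fuzzy_sets X"
    unfolding d_def using le fuzzy_setsD[OF b] fuzzy_setsD[OF c]
    by (intro fuzzy_setsI) (smt (verit))
  have "(a \<odot> c) x = (a \<odot> b) x + (a \<odot> d) x"
    using x by (intro seq_add[OF a b d c]) (auto simp: d_def)
  then show ?thesis
    using fuzzy_setsD(1)[OF seq_closed[OF a d] x] by simp
qed

lemma seq_zero:
  assumes a: "a \<in> fuzzy_sets X"
  shows "a \<odot> fuzzy_zero X = fuzzy_zero X"
proof (rule fuzzy_sets_eqI[OF seq_closed[OF a zero_closed] zero_closed])
  fix x assume x: "x \<in> X"
  have "(a \<odot> fuzzy_zero X) x = (a \<odot> fuzzy_zero X) x + (a \<odot> fuzzy_zero X) x"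
    using x by (intro seq_add[OF a zero_closed zero_closed zero_closed]) (auto simp: fuzzy_zero_def)
  then show "(a \<odot> fuzzy_zero X) x = fuzzy_zero X x"
    using x by (simp add: fuzzy_zero_def)
qed

text \<open>(S2) makes the unit neutral only on the left. From \<open>a \<odot> 0 = 0\<close>, (S3)
  gives that \<open>a\<close> commutes with 0, and (S4) that it commutes with the complement of 0,
  which is 1.\<close>

lemma seq_one:
  assumes a: "a \<in> fuzzy_sets X"
  shows "a \<odot> fuzzy_one X = a"
proof -
  have "commutes (\<odot>) a (fuzzy_zero X)"
    using a seq_zero by (intro S3) (auto intro: zero_closed)
  then have "commutes (\<odot>) a (compl (fuzzy_zero X))"
    by (intro S4_compl[OF a zero_closed])
  moreover have "compl (fuzzy_zero X) = fuzzy_one X"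
    unfolding compl_eq[OF zero_closed]
    by (simp add: fuzzy_compl_def fuzzy_zero_def fuzzy_one_def fun_eq_iff)
  ultimately show ?thesis
    using S2[OF a] by (simp add: commutes_def)
qed

text \<open>Monotonicity applied to \<open>b \<le> 1\<close>. A bound by the right factor is
  available only once the factors commute.\<close>

lemma seq_le_left:
  assumes a: "a \<in> fuzzy_sets X" and b: "b \<in> fuzzy_sets X" and x: "x \<in> X"
  shows "(a \<odot> b) x \<le> a x"
proof -
  have "(a \<odot> b) x \<le> (a \<odot> fuzzy_one X) x"
    using x by (intro seq_mono[OF a b one_closed]) (auto simp: fuzzy_one_def fuzzy_setsD[OF b])
  then show ?thesis
    by (simp add: seq_one[OF a])
qed

section \<open>Products with indicators\<close>

lemma ind_closed: "fuzzy_ind X S \<in> fuzzy_sets X"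
  by (simp add: fuzzy_ind_scaled_closed)

lemma compl_ind: "compl (fuzzy_ind X S) = fuzzy_ind X (- S)"
  by (simp add: compl_eq ind_closed fuzzy_compl_ind)

lemma ind_seq_ind_compl: "fuzzy_ind X S \<odot> fuzzy_ind X (- S) = fuzzy_zero X"
proof (rule fuzzy_sets_eqI[OF seq_closed[OF ind_closed ind_closed] zero_closed])
  fix x assume x: "x \<in> X"
  \<comment> \<open>An element trivially commutes with itself, hence by (S4) with its complement;
    the product is then below both factors, one of which vanishes at \<open>x\<close>.\<close>
  have "commutes (\<odot>) (fuzzy_ind X S) (compl (fuzzy_ind X S))"
    by (intro S4_compl ind_closed) (simp add: commutes_def)
  then have "fuzzy_ind X S \<odot> fuzzy_ind X (- S) = fuzzy_ind X (- S) \<odot> fuzzy_ind X S"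
    by (simp add: compl_ind commutes_def)
  then have "(fuzzy_ind X S \<odot> fuzzy_ind X (- S)) x \<le> fuzzy_ind X S x"
    "(fuzzy_ind X S \<odot> fuzzy_ind X (- S)) x \<le> fuzzy_ind X (- S) x"
    using seq_le_left[OF ind_closed ind_closed x] by metis+
  moreover have "0 \<le> (fuzzy_ind X S \<odot> fuzzy_ind X (- S)) x"
    by (rule fuzzy_setsD(1)[OF seq_closed[OF ind_closed ind_closed] x])
  ultimately show "(fuzzy_ind X S \<odot> fuzzy_ind X (- S)) x = fuzzy_zero X x"
    using x by (auto simp: fuzzy_restrict_def fuzzy_zero_def split: if_splits)
qed

text \<open>The restriction of \<open>a\<close> lies below the complementary indicator, so
  monotonicity reduces the claim to the product of the two indicators.\<close>

lemma ind_seq_restrict_compl: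
  assumes a: "a \<in> fuzzy_sets X"
  shows "fuzzy_ind X S \<odot> fuzzy_restrict X (- S) a = fuzzy_zero X"
proof (rule fuzzy_sets_eqI[OF seq_closed[OF ind_closed fuzzy_restrict_closed[OF a]] zero_closed])
  fix x assume x: "x \<in> X"
  have "(fuzzy_ind X S \<odot> fuzzy_restrict X (- S) a) x \<le> (fuzzy_ind X S \<odot> fuzzy_ind X (- S)) x"
    using x fuzzy_setsD[OF a]
    by (intro seq_mono ind_closed fuzzy_restrict_closed[OF a]) (auto simp: fuzzy_restrict_def)
  moreover have "0 \<le> (fuzzy_ind X S \<odot> fuzzy_restrict X (- S) a) x"
    by (rule fuzzy_setsD(1)[OF seq_closed[OF ind_closed fuzzy_restrict_closed[OF a]] x])
  ultimately show "(fuzzy_ind X S \<odot> fuzzy_restrict X (- S) a) x = fuzzy_zero X x"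
    using x by (simp add: ind_seq_ind_compl fuzzy_zero_def)
qed

lemma restrict_commutes_ind_compl:
  assumes a: "a \<in> fuzzy_sets X"
  shows "commutes (\<odot>) (fuzzy_restrict X (- S) a) (fuzzy_ind X S)"
  using S3[OF ind_closed fuzzy_restrict_closed[OF a] ind_seq_restrict_compl[OF a]]
  by (rule commutes_sym)

text \<open>The preceding lemma for \<open>- S\<close> gives commutation with the indicator of
  \<open>- S\<close>; (S4) passes to its complement.\<close>

lemma restrict_commutes_ind:
  assumes a: "a \<in> fuzzy_sets X"
  shows "commutes (\<odot>) (fuzzy_restrict X S a) (fuzzy_ind X S)"
  using S4_compl[OF fuzzy_restrict_closed[OF a] ind_closed
      restrict_commutes_ind_compl[OF a, of "- S"]]
  by (simp add: compl_ind)

text \<open>Split the unit into the two indicators in \<open>r \<odot> 1 = r\<close>; the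
  complementary one contributes 0.\<close>

lemma restrict_seq_ind:
  assumes a: "a \<in> fuzzy_sets X"
  shows "fuzzy_restrict X S a \<odot> fuzzy_ind X S = fuzzy_restrict X S a"
proof (rule fuzzy_sets_eqI[OF seq_closed[OF fuzzy_restrict_closed[OF a] ind_closed]
      fuzzy_restrict_closed[OF a]])
  let ?r = "fuzzy_restrict X S a"
  fix x assume x: "x \<in> X"
  have "?r \<odot> fuzzy_ind X (- S) = fuzzy_zero X"
    using restrict_commutes_ind_compl[OF a, of "- S"] ind_seq_restrict_compl[OF a, of "- S"]
    by (simp add: commutes_def)
  moreover have "(?r \<odot> fuzzy_one X) x = (?r \<odot> fuzzy_ind X S) x + (?r \<odot> fuzzy_ind X (- S)) x"
    using x by (intro seq_add fuzzy_restrict_closed[OF a] ind_closed one_closed)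
      (auto simp: fuzzy_restrict_def fuzzy_one_def)
  ultimately show "(?r \<odot> fuzzy_ind X S) x = ?r x"
    using x by (simp add: seq_one fuzzy_restrict_closed[OF a] fuzzy_zero_def)
qed

text \<open>Write \<open>a\<close> as the sum of its restrictions to \<open>S\<close> and
  \<open>- S\<close>, both of which commute with the indicator, and apply (S5).\<close>

lemma ind_commutes:
  assumes a: "a \<in> fuzzy_sets X"
  shows "commutes (\<odot>) (fuzzy_ind X S) a"
proof (rule S5_oplus)
  show "fuzzy_oplus X (fuzzy_restrict X S a) (fuzzy_restrict X (- S) a) = Some a"
    using a fuzzy_setsD(2)[OF a]
    by (auto simp: fuzzy_oplus_eq_Some_iff fuzzy_restrict_def fuzzy_sets_def PiE_iff
        extensional_def fun_eq_iff)
qed (rule a ind_closed fuzzy_restrict_closed[OF a] commutes_sym[OF restrict_commutes_ind[OF a]]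
    commutes_sym[OF restrict_commutes_ind_compl[OF a]])+

lemma ind_seq:
  assumes a: "a \<in> fuzzy_sets X"
  shows "fuzzy_ind X S \<odot> a = fuzzy_restrict X S a"
proof (rule fuzzy_sets_eqI[OF seq_closed[OF ind_closed a] fuzzy_restrict_closed[OF a]])
  let ?e = "fuzzy_ind X S"
  fix x assume x: "x \<in> X"
  have "(?e \<odot> a) x = (?e \<odot> fuzzy_restrict X S a) x + (?e \<odot> fuzzy_restrict X (- S) a) x"
    using x by (intro seq_add fuzzy_restrict_closed[OF a] ind_closed a)
      (auto simp: fuzzy_restrict_def)
  then show "(?e \<odot> a) x = fuzzy_restrict X S a x"
    using x restrict_commutes_ind[OF a, of S]
    by (simp add: ind_seq_restrict_compl[OF a] restrict_seq_ind[OF a] commutes_def fuzzy_zero_def)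
qed

text \<open>Locality: the values of \<open>a \<odot> b\<close> on \<open>S\<close> depend only on
  those of \<open>b\<close> on \<open>S\<close>. Multiplication by an indicator is restriction, and
  (S4) moves the indicator past \<open>a\<close>.\<close>

lemma seq_restrict:
  assumes a: "a \<in> fuzzy_sets X" and b: "b \<in> fuzzy_sets X"
  shows "a \<odot> fuzzy_restrict X S b = fuzzy_restrict X S (a \<odot> b)"
proof -
  have comm: "commutes (\<odot>) (fuzzy_ind X S) a"
    by (rule ind_commutes[OF a])
  have "a \<odot> (fuzzy_ind X S \<odot> b) = (a \<odot> fuzzy_ind X S) \<odot> b"
    by (rule S4_assoc[OF a ind_closed b commutes_sym[OF comm]])
  also have "\<dots> = (fuzzy_ind X S \<odot> a) \<odot> b"
    using comm by (simp add: commutes_def)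
  also have "\<dots> = fuzzy_ind X S \<odot> (a \<odot> b)"
    by (rule S4_assoc[OF ind_closed a b comm, symmetric])
  finally show ?thesis
    by (simp add: ind_seq a b seq_closed)
qed

section \<open>Uniqueness, one point at a time\<close>

theorem seq_eq_times:
  assumes a: "a \<in> fuzzy_sets X" and b: "b \<in> fuzzy_sets X"
  shows "a \<odot> b = fuzzy_times X a b"
proof (rule fuzzy_sets_eqI[OF seq_closed[OF a b] fuzzy_times_closed[OF a b]])
  fix x assume x: "x \<in> X"
  define \<phi> where "\<phi> t = (a \<odot> fuzzy_restrict X {x} (\<lambda>_. t)) x" for t
  have "\<phi> (b x) = b x * \<phi> 1"
  proof (rule additive_unit_interval_linear)
    fix s t :: real assume "0 \<le> s" "0 \<le> t" "s + t \<le> 1"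
    then show "\<phi> (s + t) = \<phi> s + \<phi> t"
      unfolding \<phi>_def using x
      by (intro seq_add[OF a] fuzzy_ind_scaled_closed) (auto simp: fuzzy_restrict_def)
  next
    fix t :: real assume "0 \<le> t" "t \<le> 1"
    then show "0 \<le> \<phi> t \<and> \<phi> t \<le> 1"
      unfolding \<phi>_def using fuzzy_setsD[OF seq_closed[OF a fuzzy_ind_scaled_closed] x] by blast
  qed (use fuzzy_setsD[OF b x] in auto)
  moreover have "a \<odot> fuzzy_ind X {x} = fuzzy_restrict X {x} a"
    using ind_commutes[OF a, of "{x}"] by (simp add: ind_seq[OF a] commutes_def)
  then have "\<phi> 1 = a x"
    unfolding \<phi>_def using x by (simp add: fuzzy_restrict_def)
  \<comment> \<open>At the single point \<open>x\<close>, restricting \<open>b\<close> is scaling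
    the indicator by \<open>b x\<close>, so locality turns \<open>\<phi> (b x)\<close> into the
    value of \<open>a \<odot> b\<close>.\<close>
  moreover have "fuzzy_restrict X {x} (\<lambda>_. b x) = fuzzy_restrict X {x} b"
    by (auto simp: fuzzy_restrict_def fun_eq_iff)
  then have "\<phi> (b x) = (a \<odot> b) x"
    using x by (simp add: \<phi>_def seq_restrict[OF a b]) (simp add: fuzzy_restrict_def)
  ultimately show "(a \<odot> b) x = fuzzy_times X a b x"
    using x by (simp add: fuzzy_times_apply a b mult.commute)
qed

end

theorem corollary4p7:
  fixes X :: "'x set"
  assumes "X \<noteq> {}"
  shows "\<exists>!p. p \<in> fuzzy_sets X \<rightarrow>\<^sub>E fuzzy_sets X \<rightarrow>\<^sub>E fuzzy_sets X \<and>
    sequential_product (fuzzy_sets X) (fuzzy_zero X) (fuzzy_one X) (fuzzy_oplus X) p"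
proof (rule ex1I[of _ "fuzzy_times X"])
  have closed: "fuzzy_times X \<in> fuzzy_sets X \<rightarrow>\<^sub>E fuzzy_sets X \<rightarrow>\<^sub>E fuzzy_sets X"
    unfolding fuzzy_times_def by (auto intro!: fuzzy_setsI simp: fuzzy_setsD mult_le_one)
  then show "fuzzy_times X \<in> fuzzy_sets X \<rightarrow>\<^sub>E fuzzy_sets X \<rightarrow>\<^sub>E fuzzy_sets X \<and>
    sequential_product (fuzzy_sets X) (fuzzy_zero X) (fuzzy_one X) (fuzzy_oplus X) (fuzzy_times X)"
    using sequential_product_fuzzy_times[OF assms] by blast
  fix p
  assume p: "p \<in> fuzzy_sets X \<rightarrow>\<^sub>E fuzzy_sets X \<rightarrow>\<^sub>E fuzzy_sets X \<and>
    sequential_product (fuzzy_sets X) (fuzzy_zero X) (fuzzy_one X) (fuzzy_oplus X) p"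
  then interpret fuzzy_sequential_product X p
    by (simp add: fuzzy_sequential_product_def)
  show "p = fuzzy_times X"
  \<comment> \<open>Both operations are extensional in each argument, so agreement on the carrier,
    shown in \<open>seq_eq_times\<close>, makes them equal.\<close>
  proof (rule PiE_ext)
    show "p \<in> fuzzy_sets X \<rightarrow>\<^sub>E fuzzy_sets X \<rightarrow>\<^sub>E fuzzy_sets X"
      using p by blast
    fix a assume a: "a \<in> fuzzy_sets X"
    show "p a = fuzzy_times X a"
    proof (rule PiE_ext)
      show "p a \<in> fuzzy_sets X \<rightarrow>\<^sub>E fuzzy_sets X" "fuzzy_times X a \<in> fuzzy_sets X \<rightarrow>\<^sub>E fuzzy_sets X"
        using p closed a by (auto dest: PiE_mem)
    qed (rule seq_eq_times[OF a])
  qed (rule closed)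
qed

end
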